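(* Let $\sigma_2 = 2$ and $\sigma_3 = C_0$, where $C_0 \approx 13.901$ is the constant described in the context. Let $q \in \{2,3\}$, let $k \geq 2$, and let $t_1, \ldots, t_k$ be integers with $t_k \geq t_{k-1} \geq \cdots \geq t_1 \geq 2$. Then \[R_q(t_1, \ldots, t_k) \leq \tau_h(3t_k), \qquad \text{where } h = \sum_{i=1}^{k-1}(t_i - 1) + 1,\] and $\tau_h$ denotes the tower function with base $\sigma_q$: $\tau_1(x) = x$ and $\tau_{j+1}(x) = \sigma_q^{\tau_j(x)}$ for $j \geq 1$ (so $\tau_h(3t_k)$ is a tower $\sigma_q^{\sigma_q^{\cdot^{\cdot^{\sigma_q^{3t_k}}}}}$ of height $h$, counting the top entry $3t_k$ as one level).
   Context: For a finite field $\mathbb F_q$ and positive integers $t_1,\ldots,t_k$, $R_q(t_1,\ldots,t_k)$ denotes the minimum $n$ such that for every coloring $f$ of the set of $1$-dimensional linear subspaces of $\mathbb F_q^n$ with colors $\{1,\ldots,k\}$, there exist $i \in \{1,\ldots,k\}$ and a linear subspace $U \subseteq \mathbb F_q^n$ of dimension $t_i$ such that every $1$-dimensional subspace of $U$ receives color $i$ (this minimum exists by the Graham–Leeb–Rothschild theorem). The constant $C_0 \approx 13.901$ is the absolute constant $C_0 = 1 + 1/(1-\log_3 \gamma)$ with $\gamma = \min_{0<x<1}(1+x+x^2)/x^{2/3} \approx 2.7552$ (the constant of Fox–Pham's theorem on affine subspaces in dense subsets of $\mathbb F_3^n$); it has the known property that every $A \subseteq \mathbb F_3^n$ with $|A|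 = \alpha 3^n$ contains at least $\alpha^{C_0} 3^{2n}$ triples of the form $(x, x+d, x+2d)$ with $x,d \in \mathbb F_3^n$. *)

theory Defs
  imports "HOL-Analysis.Analysis" "HOL-Library.Function_Algebras"
begin

text \<open>Vectors of F^n are modelled as functions nat => 'a vanishing outside {0..<n},
  where 'a is a finite field; scalar multiplication is pointwise.\<close>

definition vscale :: "'a::field \<Rightarrow> (nat \<Rightarrow> 'a) \<Rightarrow> (nat \<Rightarrow> 'a)" where
  "vscale c v = (\<lambda>i. c * v i)"

definition Fspace :: "nat \<Rightarrow> (nat \<Rightarrow> 'a::field) set" where
  "Fspace n = {v. \<forall>i\<ge>n. v i = 0}"

definition lin_subspace :: "nat \<Rightarrow> (nat \<Rightarrow> 'a::field) set \<Rightarrow> bool" where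
  "lin_subspace n U \<longleftrightarrow> module.subspace vscale U \<and> U \<subseteq> Fspace n"

definition sdim :: "(nat \<Rightarrow> 'a::field) set \<Rightarrow> nat" where
  "sdim U = vector_space.dim vscale U"

definition points :: "nat \<Rightarrow> (nat \<Rightarrow> 'a::field) set set" where
  "points n = {L. lin_subspace n L \<and> sdim L = 1}"

definition ramsey_prop :: "'a::{finite,field} itself \<Rightarrow> nat \<Rightarrow> (nat \<Rightarrow> nat) \<Rightarrow> nat \<Rightarrow> bool" where
  "ramsey_prop _ k t n \<longleftrightarrow>
     (\<forall>f :: (nat \<Rightarrow> 'a) set \<Rightarrow> nat. (\<forall>L\<in>points n. f L \<in> {1..k}) \<longrightarrow>
        (\<exists>i\<in>{1..k}. \<exists>U :: (nat \<Rightarrow> 'a) set. lin_subspace n U \<and> sdim U = t i \<and>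
            (\<forall>L\<in>points n. L \<subseteq> U \<longrightarrow> f L = i)))"

definition Rq :: "'a::{finite,field} itself \<Rightarrow> nat \<Rightarrow> (nat \<Rightarrow> nat) \<Rightarrow> nat" where
  "Rq T k t = (LEAST n. ramsey_prop T k t n)"

definition gamma0 :: real where
  "gamma0 = Inf ((\<lambda>x::real. (1 + x + x^2) / x powr (2/3)) ` {0<..<1})"

definition C0 :: real where
  "C0 = 1 + 1 / (1 - log 3 gamma0)"

definition sigma :: "nat \<Rightarrow> real" where
  "sigma q = (if q = 2 then 2 else C0)"

primrec tw :: "real \<Rightarrow> nat \<Rightarrow> real \<Rightarrow> real" where
  "tw s 0 x = x"
| "tw s (Suc j) x = s powr (tw s j x)"

text \<open>tau s h x: tau_1(x) = x, tau_{j+1}(x) = s^{tau_j(x)} (for h >= 1).\<close>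
definition tau :: "real \<Rightarrow> nat \<Rightarrow> real \<Rightarrow> real" where
  "tau s h x = tw s (h - 1) x"

end

theory Submission
  imports Defs
begin

text \<open>
  Colour vectors by the line they span. If the colours other than \<open>k\<close> occupy a proportion
  less than \<open>q ^ (- t k)\<close> of the space, a \<open>t k\<close>-dimensional subspace of colour \<open>k\<close> is
  found greedily. Otherwise some colour \<open>i \<noteq> k\<close> has density at least \<open>q ^ (- s)\<close> with \<open>s\<close>
  about \<open>t k\<close>, so it contains a flat \<open>x + W\<close> with \<open>W\<close> of dimension \<open>d\<close>, provided the
  dimension of the space is at least \<open>d + C ^ d * s\<close>. By induction \<open>W\<close> contains either the required
  subspace of some colour \<open>j \<noteq> i\<close>, or one of colour \<open>i\<close> and dimension \<open>t i - 1\<close>, which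
  together with \<open>x\<close> spans a subspace of colour \<open>i\<close> and dimension \<open>t i\<close>.

  Flats in dense sets are built one direction at a time: a line direction \<open>v\<close> such that many
  lines parallel to \<open>v\<close> lie in the set is obtained by supersaturation from an upper bound for
  line-free sets, which is trivial for \<open>q = 2\<close> and the cap set theorem for \<open>q = 3\<close>. The tower
  absorbs any \<open>C\<close> with \<open>C + 1 \<le> \<sigma>\<^sup>2\<close>, so crude constants suffice: \<open>C = 3\<close> for
  \<open>q = 2\<close>, and \<open>C = 32\<close> with \<open>C0 \<ge> 6\<close> for \<open>q = 3\<close>.
\<close>

section \<open>Slice rank\<close>

text \<open>
  Tao's slice rank bound for diagonal tensors, with counting in place of linear algebra: choose
  \<open>g\<close> of maximal support \<open>S\<close> orthogonal to all \<open>u e\<close>. Maximality gives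
  \<open>card A \<le> card E + card S\<close>; contracting the tensor with \<open>g\<close> leaves a diagonal matrix on
  \<open>S\<close> of rank at most \<open>2 * card E\<close>.
\<close>

lemma diagonal_tensor_card_le:
  fixes u :: "'e \<Rightarrow> 'x \<Rightarrow> 'a::{finite,field}"
    and \<kappa> :: "'f \<Rightarrow> 'a"
  assumes fin: "finite A" "finite \<Phi>" "finite E"
    and cover: "\<And>\<phi>. \<phi> \<in> \<Phi> \<Longrightarrow> e1 \<phi> \<in> E \<or> e2 \<phi> \<in> E \<or> e3 \<phi> \<in> E"
    and diag: "\<And>x y z. x \<in> A \<Longrightarrow> y \<in> A \<Longrightarrow> z \<in> A \<Longrightarrow>
      (\<Sum>\<phi>\<in>\<Phi>. \<kappa> \<phi> * u (e1 \<phi>) x * u (e2 \<phi>) y * u (e3 \<phi>) z) = (if x = y \<and> y = z then 1 else 0)"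
  shows "card A \<le> 3 * card E"
proof -
  let ?F = "\<lambda>S. (S \<rightarrow>\<^sub>E UNIV :: ('x \<Rightarrow> 'a) set)"
  let ?G = "(E \<rightarrow>\<^sub>E UNIV :: ('e \<Rightarrow> 'a) set)"
  define q where "q = CARD('a)"
  have q2: "q \<ge> 2"
  proof -
    have "card {0::'a, 1} \<le> q" unfolding q_def by (rule card_mono) auto
    then show ?thesis by simp
  qed
  have cF: "card (?F S) = q ^ card S" "finite (?F S)" if "finite S" for S
    using that by (auto simp: card_PiE q_def intro!: finite_PiE)
  have cG: "card ?G = q ^ card E" "finite ?G"
    using fin by (auto simp: card_PiE q_def intro!: finite_PiE)
  define L where "L g e = (\<Sum>x\<in>A. g x * u e x)" for g :: "'x \<Rightarrow> 'a" and e
  define X where "X = {g :: 'x \<Rightarrow> 'a. \<forall>e\<in>E. L g e = 0}"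
  define supp where "supp g = {x\<in>A. g x \<noteq> 0}" for g :: "'x \<Rightarrow> 'a"
  have "(\<lambda>x. 0) \<in> X" by (simp add: X_def L_def)
  moreover have "card (supp g) < Suc (card A)" for g
    unfolding supp_def using fin(1) by (simp add: card_mono le_imp_less_Suc)
  ultimately obtain g where g: "g \<in> X" and gmax: "\<And>g'. g' \<in> X \<Longrightarrow> card (supp g') \<le> card (supp g)"
    using ex_has_greatest_nat[of "\<lambda>g. g \<in> X" "\<lambda>x. 0" "\<lambda>g. card (supp g)" "Suc (card A)"]
    by (metis less_imp_le)
  define S where "S = supp g"
  have S: "S \<subseteq> A" "finite S" using fin(1) by (auto simp: S_def supp_def)
  \<comment> \<open>If \<open>h\<close> and \<open>h'\<close> have the same image, then
    \<open>k = h - h'\<close> is orthogonal to all \<open>u e\<close> and vanishes on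
    \<open>S\<close>. So \<open>g + k\<close> competes with \<open>g\<close>, its support is
    \<open>S\<close> together with that of \<open>k\<close>, and maximality forces
    \<open>k = 0\<close> on \<open>A\<close>.\<close>
  have "inj_on (\<lambda>h. (restrict (L h) E, restrict h S)) (?F A)"
  proof (rule inj_onI)
    fix h h' assume h: "h \<in> ?F A" "h' \<in> ?F A"
      and eq: "(restrict (L h) E, restrict h S) = (restrict (L h') E, restrict h' S)"
    define k where "k x = h x - h' x" for x
    have Lk: "L k e = 0" if "e \<in> E" for e
    proof -
      have "L h e = L h' e" using eq that by (metis Pair_inject restrict_apply')
      then show ?thesis by (simp add: L_def k_def left_diff_distrib sum_subtractf)
    qed
    have kS: "k x = 0" if "x \<in> S" for x
    proof -
      have "h x = h' x" using eq that by (metis Pair_inject restrict_apply')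
      then show ?thesis by (simp add: k_def)
    qed
    have "(\<lambda>x. g x + k x) \<in> X"
      using g Lk by (simp add: X_def L_def distrib_right sum.distrib)
    from gmax[OF this] have le: "card (supp (\<lambda>x. g x + k x)) \<le> card S" by (simp add: S_def)
    have "g x + k x \<noteq> 0 \<longleftrightarrow> g x \<noteq> 0 \<or> k x \<noteq> 0" if "x \<in> A" for x
      using kS[of x] that by (cases "g x = 0") (auto simp: supp_def S_def)
    then have un: "supp (\<lambda>x. g x + k x) = S \<union> supp k"
      by (auto simp: supp_def S_def)
    have "finite (S \<union> supp k)" using fin by (auto simp: S_def supp_def)
    with le un have "S \<union> supp k = S" by (metis card_seteq Un_upper1)
    then have "supp k \<subseteq> S" by auto
    then have "supp k = {}" using kS by (auto simp: supp_def)
    then show "h = h'"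
      using PiE_ext[OF h] by (auto simp: supp_def k_def)
  qed
  moreover have "(\<lambda>h. (restrict (L h) E, restrict h S)) ` (?F A) \<subseteq> ?G \<times> ?F S" by auto
  ultimately have "card (?F A) \<le> card (?G \<times> ?F S)"
    using cF S cG by (intro card_inj_on_le) auto
  then have "q ^ card A \<le> q ^ (card E + card S)"
    using cF fin S cG by (simp add: card_cartesian_product power_add)
  then have 1: "card A \<le> card E + card S" using q2 by simp

  \<comment> \<open>Each term is charged to its first slot whose function is indexed by
    \<open>E\<close>. Contraction with \<open>g\<close> kills \<open>\<Phi>1\<close>; terms in
    \<open>\<Phi>2\<close> see \<open>c\<close> only through \<open>P c e\<close> with
    \<open>e\<close> in \<open>E\<close>; terms in \<open>\<Phi>3\<close> are collected by their
    third function into \<open>Q\<close>.\<close>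
  define \<Phi>1 where "\<Phi>1 = {\<phi>\<in>\<Phi>. e1 \<phi> \<in> E}"
  define \<Phi>2 where "\<Phi>2 = {\<phi>\<in>\<Phi> - \<Phi>1. e2 \<phi> \<in> E}"
  define \<Phi>3 where "\<Phi>3 = \<Phi> - \<Phi>1 - \<Phi>2"
  have e3: "e3 ` \<Phi>3 \<subseteq> E" using cover by (auto simp: \<Phi>1_def \<Phi>2_def \<Phi>3_def)
  define P where "P c e = (\<Sum>y\<in>S. c y * u e y)" for c :: "'x \<Rightarrow> 'a" and e
  define Q where "Q c e = (\<Sum>\<phi>\<in>{\<phi>\<in>\<Phi>3. e3 \<phi> = e}. \<kappa> \<phi> * L g (e1 \<phi>) * P c (e2 \<phi>))" for c e
  have key: "c z * g z = (\<Sum>\<phi>\<in>\<Phi>2. \<kappa> \<phi> * L g (e1 \<phi>) * P c (e2 \<phi>) * u (e3 \<phi>) z)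
     + (\<Sum>e\<in>E. Q c e * u e z)" if z: "z \<in> S" for c z
  proof -
    have zA: "z \<in> A" using z S by auto
    have "c z * g z = (\<Sum>y\<in>S. c y * (\<Sum>x\<in>A. g x * (if x = y \<and> y = z then 1 else 0)))"
    proof -
      have "(\<Sum>x\<in>A. g x * (if x = y \<and> y = z then 1 else 0)) = (if y = z then g y else 0)"
        if "y \<in> S" for y
      proof (cases "y = z")
        case True
        have "(\<Sum>x\<in>A. g x * (if x = y \<and> y = z then 1 else 0)) = (\<Sum>x\<in>A. if x = z then g x else 0)"
          using True by (intro sum.cong) auto
        then show ?thesis using True zA fin by simp
      qed simp
      then have "(\<Sum>y\<in>S. c y * (\<Sum>x\<in>A. g x * (if x = y \<and> y = z then 1 else 0)))
         = (\<Sum>y\<in>S. if y = z then c y * g y else 0)"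
        by (intro sum.cong) auto
      also have "\<dots> = c z * g z" using z S by simp
      finally show ?thesis by simp
    qed
    also have "\<dots> = (\<Sum>y\<in>S. c y * (\<Sum>x\<in>A. g x *
        (\<Sum>\<phi>\<in>\<Phi>. \<kappa> \<phi> * u (e1 \<phi>) x * u (e2 \<phi>) y * u (e3 \<phi>) z)))"
      using diag zA S(1)
      by (intro sum.cong refl arg_cong2[of _ _ _ _ "(*)"]) (auto intro: sym simp: subset_iff)
    also have "\<dots> = (\<Sum>y\<in>S. \<Sum>x\<in>A. \<Sum>\<phi>\<in>\<Phi>.
        \<kappa> \<phi> * (g x * u (e1 \<phi>) x) * (c y * u (e2 \<phi>) y) * u (e3 \<phi>) z)"
      by (simp add: sum_distrib_left mult_ac)
    also have "\<dots> = (\<Sum>y\<in>S. \<Sum>\<phi>\<in>\<Phi>. \<Sum>x\<in>A.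
        \<kappa> \<phi> * (g x * u (e1 \<phi>) x) * (c y * u (e2 \<phi>) y) * u (e3 \<phi>) z)"
      by (intro sum.cong refl sum.swap)
    also have "\<dots> = (\<Sum>\<phi>\<in>\<Phi>. \<Sum>y\<in>S. \<Sum>x\<in>A.
        \<kappa> \<phi> * (g x * u (e1 \<phi>) x) * (c y * u (e2 \<phi>) y) * u (e3 \<phi>) z)"
      by (rule sum.swap)
    also have "\<dots> = (\<Sum>\<phi>\<in>\<Phi>. \<kappa> \<phi> * L g (e1 \<phi>) * P c (e2 \<phi>) * u (e3 \<phi>) z)"
      unfolding L_def P_def by (simp add: sum_distrib_left sum_distrib_right)
    also have "\<dots> = (\<Sum>\<phi>\<in>\<Phi>2 \<union> \<Phi>3. \<kappa> \<phi> * L g (e1 \<phi>) * P c (e2 \<phi>) * u (e3 \<phi>) z)"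
      using g fin by (intro sum.mono_neutral_right) (auto simp: \<Phi>1_def \<Phi>2_def \<Phi>3_def X_def)
    also have "\<dots> = (\<Sum>\<phi>\<in>\<Phi>2. \<kappa> \<phi> * L g (e1 \<phi>) * P c (e2 \<phi>) * u (e3 \<phi>) z)
      + (\<Sum>\<phi>\<in>\<Phi>3. \<kappa> \<phi> * L g (e1 \<phi>) * P c (e2 \<phi>) * u (e3 \<phi>) z)"
      using fin by (intro sum.union_disjoint) (auto simp: \<Phi>2_def \<Phi>3_def)
    also have "(\<Sum>\<phi>\<in>\<Phi>3. \<kappa> \<phi> * L g (e1 \<phi>) * P c (e2 \<phi>) * u (e3 \<phi>) z) =
       (\<Sum>e\<in>E. \<Sum>\<phi>\<in>{\<phi>\<in>\<Phi>3. e3 \<phi> = e}. \<kappa> \<phi> * L g (e1 \<phi>) * P c (e2 \<phi>) * u (e3 \<phi>) z)"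
      using fin e3 by (intro sum.group[symmetric]) (auto simp: \<Phi>3_def)
    also have "\<dots> = (\<Sum>e\<in>E. Q c e * u e z)"
      unfolding Q_def sum_distrib_right by (intro sum.cong) auto
    finally show ?thesis .
  qed
  \<comment> \<open>By \<open>key\<close>, the values of \<open>P c\<close> and \<open>Q c\<close>
    on \<open>E\<close> determine \<open>c z * g z\<close> for \<open>z\<close> in \<open>S\<close>,
    and \<open>g\<close> has no zero on its support; hence \<open>c\<close> is determined by
    \<open>2 * card E\<close> field elements.\<close>
  have "inj_on (\<lambda>c. (restrict (P c) E, restrict (Q c) E)) (?F S)"
  proof (rule inj_onI)
    fix c c' assume c: "c \<in> ?F S" "c' \<in> ?F S"
      and eq: "(restrict (P c) E, restrict (Q c) E) = (restrict (P c') E, restrict (Q c') E)"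
    have PQ: "P c e = P c' e" "Q c e = Q c' e" if "e \<in> E" for e
      using eq that by (metis Pair_inject restrict_apply')+
    have "c z = c' z" if z: "z \<in> S" for z
    proof -
      have "c z * g z = c' z * g z"
        unfolding key[OF z] by (intro arg_cong2[of _ _ _ _ "(+)"] sum.cong)
          (auto simp: PQ \<Phi>2_def)
      moreover have "g z \<noteq> 0" using z by (simp add: S_def supp_def)
      ultimately show ?thesis by simp
    qed
    then show "c = c'" using c by (auto intro: PiE_ext)
  qed
  moreover have "(\<lambda>c. (restrict (P c) E, restrict (Q c) E)) ` (?F S) \<subseteq> ?G \<times> ?G" by auto
  ultimately have "card (?F S) \<le> card (?G \<times> ?G)"
    using cF S cG by (intro card_inj_on_le) auto
  then have "q ^ card S \<le> q ^ (card E + card E)"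
    using cF S cG by (simp add: card_cartesian_product power_add)
  then have "card S \<le> card E + card E" using q2 by simp
  with 1 show ?thesis by simp
qed

text \<open>An exponential Markov bound: each function counted has weight
  \<open>(1/2) ^ sum e B\<close> at least \<open>(1/2) ^ (2 * r)\<close>, while the weights of all
  functions add up to \<open>(1 + 1/2 + 1/4) ^ (3 * r)\<close>. The resulting base 343/16 is below
  27, the base of the trivial count.\<close>

lemma card_low_weight_le:
  assumes "finite B" "card B = 3 * r"
  shows "card {e \<in> B \<rightarrow>\<^sub>E {0,1,2::nat}. sum e B \<le> 2 * r} * 16 ^ r \<le> 343 ^ r"
proof -
  let ?E = "{e \<in> B \<rightarrow>\<^sub>E {0,1,2::nat}. sum e B \<le> 2 * r}"
  have fin: "finite (B \<rightarrow>\<^sub>E {0,1,2::nat})" using assms by (intro finite_PiE) auto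
  have "real (card ?E) * (1/2) ^ (2 * r) = (\<Sum>e\<in>?E. (1/2) ^ (2 * r))" by simp
  also have "\<dots> \<le> (\<Sum>e\<in>?E. (1/2) ^ (sum e B))"
    by (intro sum_mono power_decreasing) auto
  also have "\<dots> \<le> (\<Sum>e\<in>B \<rightarrow>\<^sub>E {0,1,2}. (1/2) ^ (sum e B))"
    using fin by (intro sum_mono2) auto
  also have "\<dots> = (\<Sum>e\<in>B \<rightarrow>\<^sub>E {0,1,2}. \<Prod>i\<in>B. (1/2) ^ (e i))"
    by (simp add: power_sum)
  also have "\<dots> = (\<Prod>i\<in>B. \<Sum>j\<in>{0,1,2::nat}. (1/2) ^ j)"
    using assms by (subst prod_sum_PiE) auto
  also have "\<dots> = (7/4) ^ (3 * r)" using assms by (simp add: power2_eq_square)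
  finally have "real (card ?E) * (1/4) ^ r \<le> (343/64) ^ r"
    unfolding power_mult by (simp add: power2_eq_square power3_eq_cube)
  then have "real (card ?E) * (1/4) ^ r * 64 ^ r \<le> (343/64) ^ r * 64 ^ r"
    by (intro mult_right_mono) auto
  then have "real (card ?E) * 16 ^ r \<le> 343 ^ r"
    by (simp add: mult.assoc flip: power_mult_distrib)
  then show ?thesis
    by (metis (mono_tags, lifting) of_nat_le_iff of_nat_mult of_nat_numeral of_nat_power)
qed

text \<open>Only the number of elements is known, so the arithmetic is recovered by elimination: the
  third element \<open>w\<close> can only satisfy \<open>w * w = 1\<close> and
  \<open>w + 1 = 0\<close>.\<close>

lemma CARD_3_field:
  assumes "CARD('a::{finite,field}) = 3"
  shows "(1::'a) + 1 + 1 = 0" and "(a::'a) \<noteq> 0 \<Longrightarrow> a * a = 1" and "\<exists>w::'a. UNIV = {0, 1, w}"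
proof -
  obtain w :: 'a where w: "w \<noteq> 0" "w \<noteq> 1"
  proof -
    have "(UNIV :: 'a set) \<noteq> {0, 1}"
    proof
      assume "(UNIV :: 'a set) = {0, 1}"
      then have "CARD('a) = card {0::'a, 1}" by simp
      then show False using assms by simp
    qed
    then show ?thesis using that by auto
  qed
  have U: "(UNIV :: 'a set) = {0, 1, w}"
    using w assms by (intro card_seteq[symmetric]) auto
  then show "\<exists>w::'a. UNIV = {0, 1, w}" by auto
  have U': "x = 0 \<or> x = 1 \<or> x = w" for x :: 'a using U by auto
  have ww: "w * w = 1" using U'[of "w * w"] w by auto
  show "a * a = 1" if "a \<noteq> 0" using U'[of a] that ww by auto
  have w1: "w + 1 = 0" using U'[of "w + 1"] w by auto
  have "(1::'a) + 1 \<noteq> 0"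
  proof
    assume "(1::'a) + 1 = 0"
    with w1 have "w = 1" by (metis add_right_cancel)
    with w show False by simp
  qed
  moreover have "(1::'a) + 1 \<noteq> 1" by (metis add_cancel_right_right one_neq_zero)
  ultimately have "(1::'a) + 1 = w" using U'[of "1 + 1"] by metis
  then show "(1::'a) + 1 + 1 = 0" using w1 by simp
qed

section \<open>Dense sets in spaces over a finite field\<close>

text \<open>The ambient space is abstract; finite-dimensional spaces enter as spans of finite
  independent sets, so passing to a subspace only changes the basis.\<close>

locale finite_field_space = vector_space scale
  for scale :: "'a::{finite,field} \<Rightarrow> 'b::ab_group_add \<Rightarrow> 'b" (infixr \<open>\<odot>\<close> 75)
begin

text \<open>A line is a full coset of a one-dimensional subspace: a pair of distinct points over two
  elements, a three-term progression over three.\<close>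

definition line_free :: "'b set \<Rightarrow> bool" where
  "line_free A \<longleftrightarrow> (\<forall>x v. v \<noteq> 0 \<longrightarrow> (\<exists>c. x + c \<odot> v \<notin> A))"

section \<open>Sizes of spans of finite independent sets\<close>

lemma span_insert_image: "span (insert b B) = (\<lambda>(c, u). c \<odot> b + u) ` (UNIV \<times> span B)"
proof (intro equalityI subsetI)
  fix x assume "x \<in> span (insert b B)"
  then obtain k where "x - k \<odot> b \<in> span B" by (auto simp: span_insert)
  then show "x \<in> (\<lambda>(c, u). c \<odot> b + u) ` (UNIV \<times> span B)"
    by (intro image_eqI[of _ _ "(k, x - k \<odot> b)"]) auto
next
  fix x assume "x \<in> (\<lambda>(c, u). c \<odot> b + u) ` (UNIV \<times> span B)"
  then obtain c u where "x = c \<odot> b + u" "u \<in> span B" by auto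
  then show "x \<in> span (insert b B)"
    by (auto simp: span_insert intro!: exI[of _ c])
qed

lemma card_span:
  assumes "finite B" "independent B"
  shows "finite (span B)" and "card (span B) = CARD('a) ^ card B"
proof -
  have "finite (span B) \<and> card (span B) = CARD('a) ^ card B"
    using assms
  proof (induction B rule: finite_induct)
    case (insert b B)
    then have b: "b \<notin> span B" and B: "independent B" by (auto simp: independent_insert)
    have "inj_on (\<lambda>(c, u). c \<odot> b + u) (UNIV \<times> span B)"
    proof (rule inj_onI, clarify)
      fix c u c' u' assume u: "u \<in> span B" "u' \<in> span B" and eq: "c \<odot> b + u = c' \<odot> b + u'"
      have "(c - c') \<odot> b = u' - u" using eq by (simp add: scale_left_diff_distrib algebra_simps)
      then have "(c - c') \<odot> b \<in> span B" using u by (simp add: span_diff)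
      then have "c = c'"
        using b span_scale[of "(c - c') \<odot> b" B "inverse (c - c')"] by (cases "c = c'") auto
      with eq show "c = c' \<and> u = u'" by simp
    qed
    with insert B show ?case
      by (simp add: span_insert_image card_image card_cartesian_product)
  qed simp
  then show "finite (span B)" "card (span B) = CARD('a) ^ card B" by auto
qed

section \<open>Line-free sets over a field with three elements\<close>

text \<open>
  Over three elements, \<open>x + y + z = 0\<close> means that \<open>x, y, z\<close> are equal or form a line, and
  \<open>1 - s\<^sup>2\<close> is the indicator of \<open>s = 0\<close>; hence the coordinatewise product of
  \<open>1 - (x i + y i + z i)\<^sup>2\<close> is diagonal on a line-free set.
\<close>

lemma line_free_card_le_CARD_3:
  assumes q: "CARD('a) = 3" and B: "finite B" "independent B" "card B = 3 * r"
    and A: "A \<subseteq> span B" "line_free A"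
  shows "card A * 16 ^ r \<le> 3 * 343 ^ r"
proof -
  note F3 = CARD_3_field[OF q]
  define \<rho> where "\<rho> = representation B"
  define T :: "(nat \<times> nat \<times> nat) set" where
    "T = {(0,0,0), (2,0,0), (0,2,0), (0,0,2), (1,1,0), (1,0,1), (0,1,1)}"
  have T2: "a + b + c \<le> 2" if "(a, b, c) \<in> T" for a b c
    using that by (auto simp: T_def)
  have finT: "finite T" by (simp add: T_def)
  \<comment> \<open>Coefficients of the monomials of \<open>1 - (x + y + z)^2\<close>; the test for
    an exponent 1 in the first two places detects exactly the three mixed products.\<close>
  define \<kappa> :: "nat \<times> nat \<times> nat \<Rightarrow> 'a" where
    "\<kappa> = (\<lambda>(a, b, c). if a + b + c = 0 then 1 else if a = 1 \<or> b = 1 then - 2 else - 1)"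
  have expand: "1 - (x + y + z)\<^sup>2 = (\<Sum>t\<in>T. \<kappa> t * x ^ fst t * y ^ fst (snd t) * z ^ snd (snd t))"
    for x y z :: 'a
    by (simp add: T_def \<kappa>_def algebra_simps power2_eq_square)
  define u where "u e x = (\<Prod>i\<in>B. \<rho> x i ^ e i)" for e :: "'b \<Rightarrow> nat" and x
  define e1 where "e1 \<phi> = (\<lambda>i\<in>B. fst (\<phi> i))" for \<phi> :: "'b \<Rightarrow> nat \<times> nat \<times> nat"
  define e2 where "e2 \<phi> = (\<lambda>i\<in>B. fst (snd (\<phi> i)))" for \<phi> :: "'b \<Rightarrow> nat \<times> nat \<times> nat"
  define e3 where "e3 \<phi> = (\<lambda>i\<in>B. snd (snd (\<phi> i)))" for \<phi> :: "'b \<Rightarrow> nat \<times> nat \<times> nat"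
  define E where "E = {e \<in> B \<rightarrow>\<^sub>E {0,1,2::nat}. sum e B \<le> 2 * r}"
  have "card A \<le> 3 * card E"
  proof (rule diagonal_tensor_card_le)
    show "finite A" using A card_span(1) B finite_subset by blast
    show "finite (B \<rightarrow>\<^sub>E T)" using B finT by (intro finite_PiE) auto
    have "finite (B \<rightarrow>\<^sub>E {0,1,2::nat})" using B by (intro finite_PiE) auto
    then show "finite E" by (simp add: E_def)
  next
    fix \<phi> assume \<phi>: "\<phi> \<in> B \<rightarrow>\<^sub>E T"
    have \<phi>T: "\<phi> i \<in> T" if "i \<in> B" for i using \<phi> that by auto
    have mem: "e1 \<phi> \<in> B \<rightarrow>\<^sub>E {0,1,2}" "e2 \<phi> \<in> B \<rightarrow>\<^sub>E {0,1,2}" "e3 \<phi> \<in> B \<rightarrow>\<^sub>E {0,1,2}"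
      using \<phi>T by (fastforce simp: e1_def e2_def e3_def T_def)+
    \<comment> \<open>Every coordinate contributes total degree at most 2, hence at most
      \<open>6 * r\<close> overall, and one of the three exponent functions has weight at most
      \<open>2 * r\<close>.\<close>
    have "sum (e1 \<phi>) B + sum (e2 \<phi>) B + sum (e3 \<phi>) B
        = (\<Sum>i\<in>B. fst (\<phi> i) + fst (snd (\<phi> i)) + snd (snd (\<phi> i)))"
      by (simp add: e1_def e2_def e3_def sum.distrib)
    also have "\<dots> \<le> (\<Sum>i\<in>B. 2)"
      using \<phi>T T2 by (intro sum_mono) (metis prod.collapse)
    also have "\<dots> = 6 * r" using B by simp
    finally show "e1 \<phi> \<in> E \<or> e2 \<phi> \<in> E \<or> e3 \<phi> \<in> E" using mem by (auto simp: E_def)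
  next
    fix x y z assume xyz: "x \<in> A" "y \<in> A" "z \<in> A"
    then have sp: "x \<in> span B" "y \<in> span B" "z \<in> span B" using A by auto
    let ?s = "\<lambda>i. \<rho> x i + \<rho> y i + \<rho> z i"
    have "(\<Sum>\<phi>\<in>B \<rightarrow>\<^sub>E T. (\<Prod>i\<in>B. \<kappa> (\<phi> i)) * u (e1 \<phi>) x * u (e2 \<phi>) y * u (e3 \<phi>) z)
      = (\<Sum>\<phi>\<in>B \<rightarrow>\<^sub>E T. \<Prod>i\<in>B. \<kappa> (\<phi> i) * \<rho> x i ^ fst (\<phi> i) * \<rho> y i ^ fst (snd (\<phi> i))
           * \<rho> z i ^ snd (snd (\<phi> i)))"
      by (simp add: u_def e1_def e2_def e3_def prod.distrib)
    also have "\<dots> = (\<Prod>i\<in>B. 1 - (?s i)\<^sup>2)"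
      unfolding expand using B finT by (subst prod_sum_PiE) auto
    also have "\<dots> = (if x = y \<and> y = z then 1 else 0)"
    proof (cases "x = y \<and> y = z")
      case True
      have "a + a + a = 0" for a :: 'a
        using F3(1) by (metis distrib_left mult.right_neutral mult_zero_right)
      then have "?s i = 0" for i using True by metis
      then have "(\<Prod>i\<in>B. 1 - (?s i)\<^sup>2) = 1" by (simp only:) simp
      with True show ?thesis by simp
    next
      case False
      have "x + y + z \<noteq> 0"
      proof
        assume 0: "x + y + z = 0"
        have triple: "a + a + a = 0" for a :: 'b
          using F3(1) scale_left_distrib[of _ _ a] by (metis scale_one scale_zero_left)
        have "y \<noteq> x"
        proof
          assume "y = x"
          with 0 triple[of x] have "z = x" by (metis add_left_cancel)
          with \<open>y = x\<close> False show False by simp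
        qed
        \<comment> \<open>The third point of the line through \<open>x\<close> and \<open>y\<close>
          is \<open>2 y - x = - x - y = z\<close>, so the whole line would lie in
          \<open>A\<close>.\<close>
        have "x + c \<odot> (y - x) \<in> A" for c
        proof -
          obtain w where w: "UNIV = {0, 1, w :: 'a}" using F3(3) by blast
          have "(1::'a) + 1 \<noteq> 0" "(1::'a) + 1 \<noteq> 1"
            using F3(1) by (metis add_cancel_right_right add_0 one_neq_zero)+
          then have c: "c = 0 \<or> c = 1 \<or> c = 1 + 1" using w by (metis UNIV_I insertE singletonD)
          have "x + (1 + 1) \<odot> (y - x) = y + y - x"
            by (simp only: scale_left_distrib scale_one) simp
          also have "\<dots> = z"
          proof -
            have "z = - x - y" using 0 by (simp add: eq_neg_iff_add_eq_0 algebra_simps)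
            moreover have "y + y = - y" using triple[of y] by (simp add: eq_neg_iff_add_eq_0)
            ultimately show ?thesis by simp
          qed
          finally show ?thesis using c xyz by auto
        qed
        then show False
          using A(2) \<open>y \<noteq> x\<close> unfolding line_free_def by (metis right_minus_eq)
      qed
      have "\<exists>i\<in>B. ?s i \<noteq> 0"
      proof (rule ccontr)
        assume "\<not> (\<exists>i\<in>B. ?s i \<noteq> 0)"
        then have "\<rho> (x + y + z) i = 0" if "i \<in> B" for i
          using that sp B by (simp add: \<rho>_def representation_add span_add)
        moreover have "(\<Sum>i\<in>B. \<rho> (x + y + z) i \<odot> i) = x + y + z"
          unfolding \<rho>_def using sp B by (intro sum_representation_eq) (auto intro: span_add)
        ultimately show False using \<open>x + y + z \<noteq> 0\<close> by simp
      qed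
      then obtain i where "i \<in> B" "1 - (?s i)\<^sup>2 = 0"
        using F3(2) by (auto simp: power2_eq_square)
      then have "(\<Prod>i\<in>B. 1 - (?s i)\<^sup>2) = 0" using B by (intro prod_zero) auto
      with False show ?thesis by auto
    qed
    finally show "(\<Sum>\<phi>\<in>B \<rightarrow>\<^sub>E T. (\<Prod>i\<in>B. \<kappa> (\<phi> i)) * u (e1 \<phi>) x * u (e2 \<phi>) y * u (e3 \<phi>) z)
        = (if x = y \<and> y = z then 1 else 0)" .
  qed
  then have "card A * 16 ^ r \<le> 3 * (card E * 16 ^ r)" by simp
  also have "\<dots> \<le> 3 * 343 ^ r" using card_low_weight_le B by (simp add: E_def)
  finally show ?thesis .
qed

section \<open>Line directions in dense sets\<close>

text \<open>
  The only input from the cap set problem; \<open>C * s\<close> is the loss of density in passing to a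
  line direction.
\<close>

definition cap_exponent :: "nat \<Rightarrow> bool" where
  "cap_exponent C \<longleftrightarrow> (\<forall>s\<ge>2. \<exists>m. m + s + 1 \<le> C * s \<and>
     (\<forall>B A. finite B \<and> independent B \<and> card B = m \<and> A \<subseteq> span B \<and> line_free A \<longrightarrow>
        card A * CARD('a) ^ (s + 1) \<le> CARD('a) ^ m))"

lemma CARD_ge_2: "CARD('a) \<ge> 2"
proof -
  have "card {0::'a, 1} \<le> CARD('a)" by (rule card_mono) auto
  then show ?thesis by simp
qed

text \<open>Any two distinct points form a line, so a line-free set has at most one point and
  dimension \<open>m = s + 1\<close> suffices; \<open>2 * s + 2\<close> is at most
  \<open>3 * s\<close> because \<open>s\<close> is at least 2.\<close>

lemma cap_exponent_CARD_2:
  assumes "CARD('a) = 2"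
  shows "cap_exponent 3"
proof -
  have U: "(UNIV :: 'a set) = {0, 1}" using assms by (intro card_seteq[symmetric]) auto
  have bound: "card A \<le> 1" if "finite B" "independent B" "A \<subseteq> span B" "line_free A" for A B
  proof -
    have "finite A" using that card_span(1) finite_subset by blast
    moreover have "a = b" if "a \<in> A" "b \<in> A" for a b
    proof (rule ccontr)
      assume "a \<noteq> b"
      then obtain c where "a + c \<odot> (b - a) \<notin> A"
        using \<open>line_free A\<close> unfolding line_free_def by (metis right_minus_eq)
      moreover have "c = 0 \<or> c = 1" using U by auto
      ultimately show False using that by auto
    qed
    ultimately show ?thesis by (auto simp: card_le_Suc0_iff_eq)
  qed
  show ?thesis
    unfolding cap_exponent_def assms
  proof (intro allI impI)
    fix s :: nat assume "2 \<le> s"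
    with bound show "\<exists>m. m + s + 1 \<le> 3 * s \<and> (\<forall>B A. finite B \<and> independent B \<and> card B = m \<and>
        A \<subseteq> span B \<and> line_free A \<longrightarrow> card A * 2 ^ (s + 1) \<le> 2 ^ m)"
      by (intro exI[of _ "s + 1"]) auto
  qed
qed

text \<open>Fifteen dimensions, that is five units of \<open>r\<close>, gain a factor 3, since
  \<open>3 * 343 ^ 5\<close> is at most \<open>(27 * 16) ^ 5\<close>. The loss to beat is
  \<open>3 ^ (s + 2)\<close>, counting the leading 3 of the cap bound, so
  \<open>m = 15 * (s + 2)\<close>; then \<open>m + s + 1 = 16 * s + 31\<close> is at most
  \<open>32 * s\<close>.\<close>

lemma cap_exponent_CARD_3:
  assumes "CARD('a) = 3"
  shows "cap_exponent 32"
  unfolding cap_exponent_def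
proof (intro allI impI)
  fix s :: nat assume s: "2 \<le> s"
  let ?r = "5 * (s + 2)"
  have "card A * 3 ^ (s + 1) \<le> 3 ^ (3 * ?r)"
    if "finite B" "independent B" "card B = 3 * ?r" "A \<subseteq> span B" "line_free A" for A B
  proof -
    have "(card A * 3 ^ (s + 1)) * 16 ^ ?r = (card A * 16 ^ ?r) * 3 ^ (s + 1)" by simp
    also have "\<dots> \<le> (3 * 343 ^ ?r) * 3 ^ (s + 1)"
      using line_free_card_le_CARD_3[OF assms that] by (intro mult_right_mono) auto
    also have "\<dots> = (3 * 343 ^ 5) ^ (s + 2)"
      unfolding power_mult power_mult_distrib by simp
    also have "\<dots> \<le> (27 ^ 5 * 16 ^ 5) ^ (s + 2)" by (intro power_mono) auto
    also have "\<dots> = 3 ^ (3 * ?r) * 16 ^ ?r"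
      unfolding power_mult power_mult_distrib by simp
    finally show ?thesis by simp
  qed
  then show "\<exists>m. m + s + 1 \<le> 32 * s \<and>
     (\<forall>B A. finite B \<and> independent B \<and> card B = m \<and> A \<subseteq> span B \<and> line_free A \<longrightarrow>
        card A * CARD('a) ^ (s + 1) \<le> CARD('a) ^ m)"
    using s by (intro exI[of _ "3 * ?r"]) (auto simp: assms)
qed

text \<open>
  Supersaturation: the points of \<open>A\<close> on no line of \<open>A\<close> with direction in a fixed
  \<open>m\<close>-dimensional subspace form a line-free set in each coset of it, so they are few; the
  remaining points share fewer than \<open>q ^ m\<close> directions.
\<close>

lemma dense_set_line_direction:
  assumes C: "cap_exponent C" and B: "finite B" "independent B" and A: "A \<subseteq> span B"
    and s: "2 \<le> s" and dense: "CARD('a) ^ card B \<le> card A * CARD('a) ^ s"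
    and big: "C * s \<le> card B"
  obtains v where "v \<in> span B" "v \<noteq> 0"
    "CARD('a) ^ card B \<le> card {x. \<forall>c. x + c \<odot> v \<in> A} * CARD('a) ^ (C * s)"
proof -
  define q where "q = CARD('a)"
  have q2: "q \<ge> 2" using CARD_ge_2 by (simp add: q_def)
  define n where "n = card B"
  obtain m where m: "m + s + 1 \<le> C * s"
    and cap: "\<And>B A. finite B \<Longrightarrow> independent B \<Longrightarrow> card B = m \<Longrightarrow> A \<subseteq> span B \<Longrightarrow> line_free A \<Longrightarrow>
        card A * q ^ (s + 1) \<le> q ^ m"
    using C s unfolding cap_exponent_def q_def by blast
  have mn: "m \<le> n" using m big by (simp add: n_def)
  then obtain B1 where B1: "B1 \<subseteq> B" "card B1 = m"
    using obtain_subset_with_card_n unfolding n_def by metis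
  have fin1: "finite B1" "finite (B - B1)" using B B1 finite_subset by auto
  have ind: "independent B1" "independent (B - B1)" using B B1 independent_mono by auto
  have card2: "card (B - B1) = n - m" using B B1 fin1 by (simp add: card_Diff_subset n_def)
  note sp1 = card_span[OF fin1(1) ind(1)] and sp2 = card_span[OF fin1(2) ind(2)]
  have finA: "finite A" using A card_span(1)[OF B] finite_subset by blast
  define L where "L v = {x. \<forall>c. x + c \<odot> v \<in> A}" for v
  have LA: "L v \<subseteq> A" for v
  proof
    fix x assume "x \<in> L v"
    then have "x + 0 \<odot> v \<in> A" unfolding L_def by blast
    then show "x \<in> A" by simp
  qed
  define U where "U = (\<Union>v\<in>span B1 - {0}. L v)"
  define D where "D w = {u \<in> span B1. u + w \<in> A - U}" for w
  have "A - U \<subseteq> (\<Union>w\<in>span (B - B1). (\<lambda>u. u + w) ` D w)"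
  proof
    fix a assume a: "a \<in> A - U"
    then have "a \<in> span (B1 \<union> (B - B1))" using A B1 by (auto simp: Un_absorb1)
    then obtain u w where "a = u + w" "u \<in> span B1" "w \<in> span (B - B1)"
      unfolding span_Un by blast
    then show "a \<in> (\<Union>w\<in>span (B - B1). (\<lambda>u. u + w) ` D w)" using a by (auto simp: D_def)
  qed
  moreover have finD: "finite (D w)" for w using sp1 by (simp add: D_def)
  ultimately have "card (A - U) \<le> card (\<Union>w\<in>span (B - B1). (\<lambda>u. u + w) ` D w)"
    using sp2 by (intro card_mono) auto
  also have "\<dots> \<le> (\<Sum>w\<in>span (B - B1). card ((\<lambda>u. u + w) ` D w))"
    by (rule card_UN_le[OF sp2(1)])
  also have "\<dots> \<le> (\<Sum>w\<in>span (B - B1). card (D w))"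
    using finD by (intro sum_mono card_image_le)
  finally have "card (A - U) * q ^ (s + 1) \<le> (\<Sum>w\<in>span (B - B1). card (D w)) * q ^ (s + 1)"
    by (intro mult_right_mono) auto
  also have "\<dots> = (\<Sum>w\<in>span (B - B1). card (D w) * q ^ (s + 1))" by (rule sum_distrib_right)
  also have "\<dots> \<le> (\<Sum>w\<in>span (B - B1). q ^ m)"
  proof (intro sum_mono cap[OF fin1(1) ind(1) B1(2)])
    fix w
    show "D w \<subseteq> span B1" by (auto simp: D_def)
    show "line_free (D w)"
      unfolding line_free_def
    proof (intro allI impI, rule ccontr)
      fix x v :: 'b assume v: "v \<noteq> 0" and "\<nexists>c. x + c \<odot> v \<notin> D w"
      then have all: "x + c \<odot> v \<in> D w" for c by blast
      have x: "x \<in> D w" using all[of 0] by simp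
      have "x + v \<in> span B1" using all[of 1] by (simp add: D_def)
      then have "v \<in> span B1 - {0}" using x v by (simp add: D_def span_add_eq)
      moreover have "x + w \<in> L v" using all by (auto simp: L_def D_def add_ac)
      ultimately show False using x by (auto simp: D_def U_def)
    qed
  qed
  also have "\<dots> = q ^ n"
    using sp2(2) mn by (simp add: card2 q_def flip: power_add)
  finally have AU: "card (A - U) * q ^ (s + 1) \<le> q ^ n" .
  have "U \<subseteq> A" using LA by (auto simp: U_def)
  then have "card A = card U + card (A - U)"
    using finA by (metis card_Diff_subset card_mono finite_subset le_add_diff_inverse)
  \<comment> \<open>One extra factor \<open>q\<close>, at least 2, pays for two copies of
    \<open>q ^ n\<close>: at most one is lost to \<open>A - U\<close>, and \<open>U\<close> keeps
    the other.\<close>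
  moreover have "2 * q ^ n \<le> card A * q ^ (s + 1)"
  proof -
    have "2 * q ^ n \<le> q * (card A * q ^ s)"
      using dense q2 by (intro mult_mono) (auto simp: n_def q_def)
    then show ?thesis by (simp add: mult_ac)
  qed
  ultimately have U: "q ^ n \<le> card U * q ^ (s + 1)"
    using AU by (simp add: algebra_simps)
  \<comment> \<open>Pigeonhole over the nonzero directions; there are strictly fewer than
    \<open>q ^ m\<close> of them, which makes the contradiction strict.\<close>
  have "\<exists>v\<in>span B1 - {0}. q ^ n \<le> card (L v) * q ^ (C * s)"
  proof (rule ccontr)
    assume none: "\<not> ?thesis"
    have small: "card (L v) * q ^ (m + s + 1) \<le> q ^ n" if "v \<in> span B1 - {0}" for v
    proof -
      have "card (L v) * q ^ (m + s + 1) \<le> card (L v) * q ^ (C * s)"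
        using m q2 by (intro mult_left_mono power_increasing) auto
      also have "\<dots> \<le> q ^ n" using none that by (meson linear)
      finally show ?thesis .
    qed
    have "card U \<le> (\<Sum>v\<in>span B1 - {0}. card (L v))"
      unfolding U_def using sp1(1) by (intro card_UN_le) auto
    then have "card U * q ^ (m + s + 1) \<le> (\<Sum>v\<in>span B1 - {0}. card (L v)) * q ^ (m + s + 1)"
      by (intro mult_right_mono) auto
    also have "\<dots> \<le> (\<Sum>v\<in>span B1 - {0}. q ^ n)"
      unfolding sum_distrib_right by (intro sum_mono small)
    also have "\<dots> = card (span B1 - {0}) * q ^ n" by simp
    also have "\<dots> < card (span B1) * q ^ n"
      using sp1(1) q2 span_zero by (intro mult_strict_right_mono psubset_card_mono) auto
    also have "\<dots> = q ^ m * q ^ n" using sp1(2) B1 by (simp add: q_def)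
    also have "\<dots> \<le> q ^ m * (card U * q ^ (s + 1))" using U by (intro mult_left_mono) auto
    finally show False by (simp add: power_add mult_ac)
  qed
  then obtain v where v: "v \<in> span B1" "v \<noteq> 0" "q ^ n \<le> card (L v) * q ^ (C * s)" by blast
  then show ?thesis
    using that[of v] span_mono[OF B1(1)] by (auto simp: L_def n_def q_def)
qed

section \<open>Flats in dense sets\<close>

text \<open>Exchange: \<open>v\<close> has a nonzero coordinate at some \<open>b\<close> and can
  replace \<open>b\<close> in the basis, so the remaining vectors span a hyperplane complementary to
  the line of \<open>v\<close>.\<close>

lemma obtain_complement_hyperplane:
  assumes B: "independent B" and v: "v \<in> span B" "v \<noteq> 0"
  obtains b where "b \<in> B" "v \<notin> span (B - {b})" "\<And>x. x \<in> span B \<Longrightarrow> \<exists>c. x + c \<odot> v \<in> span (B - {b})"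
proof -
  have "\<exists>b. representation B v b \<noteq> 0"
  proof (rule ccontr)
    assume "\<nexists>b. representation B v b \<noteq> 0"
    then have "{b. representation B v b \<noteq> 0} = {}" by auto
    then show False using sum_nonzero_representation_eq[OF B v(1)] v(2) by simp
  qed
  then obtain b where b: "representation B v b \<noteq> 0" by blast
  then have bB: "b \<in> B" by (rule representation_ne_zero)
  have nv: "v \<notin> span (B - {b})"
  proof
    assume "v \<in> span (B - {b})"
    then have "representation B v = representation (B - {b}) v"
      using B by (intro representation_extend) auto
    then show False using b representation_ne_zero[of "B - {b}" v b] by auto
  qed
  have "b \<in> span (insert v (B - {b}))"
    using v(1) nv bB by (simp add: in_span_insert insert_absorb)
  then have "B \<subseteq> span (insert v (B - {b}))" by (auto intro: span_base)
  then have sub: "span B \<subseteq> span (insert v (B - {b}))" by (simp add: span_minimal)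
  have "\<exists>c. x + c \<odot> v \<in> span (B - {b})" if x: "x \<in> span B" for x
  proof -
    obtain k where "x - k \<odot> v \<in> span (B - {b})" using x sub by (auto simp: span_insert)
    then show ?thesis by (intro exI[of _ "- k"]) simp
  qed
  then show ?thesis using that bB nv by blast
qed

text \<open>Each step finds a direction \<open>v\<close>, restricts to a hyperplane complementary to
  \<open>v\<close> at the price of replacing \<open>s\<close> by \<open>C * s\<close>, and adds
  \<open>v\<close> to a flat found there. One dimension and one power of \<open>C\<close> are spent
  per step.\<close>

lemma dense_set_contains_flat:
  assumes C: "cap_exponent C"
  shows "finite B \<Longrightarrow> independent B \<Longrightarrow> A \<subseteq> span B \<Longrightarrow> 2 \<le> s \<Longrightarrow>
    CARD('a) ^ card B \<le> card A * CARD('a) ^ s \<Longrightarrow> d + C ^ d * s \<le> card B \<Longrightarrow>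
    \<exists>x D. finite D \<and> independent D \<and> D \<subseteq> span B \<and> card D = d \<and> (\<forall>u\<in>span D. x + u \<in> A)"
proof (induction d arbitrary: B A s)
  case 0
  have "A \<noteq> {}" using 0(5) by auto
  then obtain x where "x \<in> A" by auto
  then show ?case by (intro exI[of _ x] exI[of _ "{}"]) (auto simp: independent_empty)
next
  case (Suc d)
  note B = Suc.prems(1,2)
  \<comment> \<open>The instance \<open>s = 2\<close> of the definition already forces
    \<open>C\<close> to be at least 2.\<close>
  obtain m where "m + 2 + 1 \<le> C * 2" using C by (auto simp: cap_exponent_def)
  then have C1: "C \<ge> 2" by simp
  then have "C * s \<le> C ^ Suc d * s" by simp
  then have "C * s \<le> card B" using Suc.prems(6) by linarith
  then obtain v where v: "v \<in> span B" "v \<noteq> 0"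
    and dense: "CARD('a) ^ card B \<le> card {x. \<forall>c. x + c \<odot> v \<in> A} * CARD('a) ^ (C * s)"
    using dense_set_line_direction[OF C B Suc.prems(3-5)] by blast
  define L where "L = {x. \<forall>c. x + c \<odot> v \<in> A}"
  have LA: "L \<subseteq> A"
  proof
    fix x assume "x \<in> L"
    then have "x + 0 \<odot> v \<in> A" unfolding L_def by blast
    then show "x \<in> A" by simp
  qed
  obtain b where b: "b \<in> B" "v \<notin> span (B - {b})"
    and proj: "\<And>x. x \<in> span B \<Longrightarrow> \<exists>c. x + c \<odot> v \<in> span (B - {b})"
    using obtain_complement_hyperplane[OF B(2) v] by blast
  let ?B = "B - {b}"
  have B': "finite ?B" "independent ?B" using B independent_mono[of B ?B] by auto
  have cardB: "card B = Suc (card ?B)" using B b by (metis card_Suc_Diff1)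
  define A' where "A' = L \<inter> span ?B"
  have finA': "finite A'" using card_span(1)[OF B'] by (simp add: A'_def)
  \<comment> \<open>\<open>L\<close> is a union of lines parallel to \<open>v\<close>, each meeting
    the hyperplane in a point of \<open>A'\<close>. So \<open>L\<close> has at most
    \<open>CARD('a) * card A'\<close> points, and the slice is as dense in the hyperplane as
    \<open>L\<close> is in the space.\<close>
  have "L \<subseteq> (\<lambda>(c, y). y - c \<odot> v) ` (UNIV \<times> A')"
  proof
    fix x assume x: "x \<in> L"
    then obtain c where c: "x + c \<odot> v \<in> span ?B" using proj LA Suc.prems(3) by blast
    have "x + c \<odot> v + c' \<odot> v \<in> A" for c'
    proof -
      have "x + (c + c') \<odot> v \<in> A" using x unfolding L_def by blast
      then show ?thesis by (simp add: scale_left_distrib add_ac)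
    qed
    then have "x + c \<odot> v \<in> A'" using c by (simp add: A'_def L_def)
    then show "x \<in> (\<lambda>(c, y). y - c \<odot> v) ` (UNIV \<times> A')"
      by (intro image_eqI[of _ _ "(c, x + c \<odot> v)"]) auto
  qed
  then have "card L \<le> card (UNIV \<times> A' :: ('a \<times> 'b) set)"
    using finA' by (intro surj_card_le) auto
  then have "card L \<le> CARD('a) * card A'" by (simp add: card_cartesian_product)
  then have "CARD('a) ^ card B \<le> CARD('a) * card A' * CARD('a) ^ (C * s)"
    using dense order_trans mult_right_mono[of "card L" "CARD('a) * card A'" "CARD('a) ^ (C * s)"]
    unfolding L_def by blast
  then have dense': "CARD('a) ^ card ?B \<le> card A' * CARD('a) ^ (C * s)"
    by (simp add: cardB mult.assoc)
  have "2 \<le> C * s" using mult_le_mono[OF C1 Suc.prems(4)] by simp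
  moreover have "d + C ^ d * (C * s) \<le> card ?B" using Suc.prems(6) cardB by (simp add: mult_ac)
  ultimately obtain x D where D: "finite D" "independent D" "D \<subseteq> span ?B" "card D = d"
    and flat: "\<And>u. u \<in> span D \<Longrightarrow> x + u \<in> A'"
    using Suc.IH[OF B' _ _ dense'] by (auto simp: A'_def)
  have "span D \<subseteq> span ?B" using D(3) by (simp add: span_minimal)
  with b have vD: "v \<notin> span D" by auto
  then have "v \<notin> D" using span_base by blast
  show ?case
  proof (intro exI[of _ x] exI[of _ "insert v D"] conjI ballI)
    show "finite (insert v D)" "independent (insert v D)" "card (insert v D) = Suc d"
      using D vD \<open>v \<notin> D\<close> by (auto simp: independent_insertI)
    show "insert v D \<subseteq> span B" using D(3) v span_mono[of ?B B] by auto
  next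
    fix u assume "u \<in> span (insert v D)"
    then obtain k where "u - k \<odot> v \<in> span D" by (auto simp: span_insert)
    then have "x + (u - k \<odot> v) \<in> L" using flat by (auto simp: A'_def)
    then have "x + (u - k \<odot> v) + k \<odot> v \<in> A" unfolding L_def by blast
    then show "x + u \<in> A" by simp
  qed
qed

end

section \<open>Monochromatic subspaces\<close>

text \<open>
  Dimension sufficient for Ramsey with target \<open>T\<close> for the last colour and
  \<open>p\<close> = sum of \<open>t i - 1\<close> over the other colours.
\<close>

primrec ramsey_bound :: "nat \<Rightarrow> nat \<Rightarrow> nat \<Rightarrow> nat" where
  "ramsey_bound C T 0 = T"
| "ramsey_bound C T (Suc p) = ramsey_bound C T p + C ^ ramsey_bound C T p * (T + p)"

lemma ramsey_bound_ge: "T \<le> ramsey_bound C T p"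
  by (induction p) auto

context finite_field_space
begin

text \<open>Greedy extension: a vector \<open>v\<close> outside \<open>insert 0 Z + span D\<close>
  exists by counting. If \<open>k v + u\<close> with \<open>u\<close> in \<open>span D\<close> were
  in \<open>Z\<close>, then \<open>k\<close> would be nonzero, and dividing by \<open>k\<close>
  would put \<open>v\<close> into that sumset.\<close>

lemma subspace_avoiding_small_set:
  assumes B: "finite B" "independent B" and Z: "0 \<notin> Z" "Z \<subseteq> span B"
    and hom: "\<And>c z. c \<noteq> 0 \<Longrightarrow> z \<in> Z \<Longrightarrow> c \<odot> z \<in> Z"
  shows "card (insert 0 Z) * CARD('a) ^ j \<le> CARD('a) ^ card B \<Longrightarrow>
    \<exists>D. finite D \<and> independent D \<and> D \<subseteq> span B \<and> card D = j \<and> span D \<inter> Z = {}"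
proof (induction j)
  case 0
  show ?case using Z by (intro exI[of _ "{}"]) (auto simp: independent_empty)
next
  case (Suc j)
  have finZ: "finite Z" using Z card_span(1)[OF B] finite_subset by blast
  have less: "card (insert 0 Z) * CARD('a) ^ j < card (insert 0 Z) * CARD('a) ^ Suc j"
  proof (rule mult_strict_left_mono)
    show "CARD('a) ^ j < CARD('a) ^ Suc j" using CARD_ge_2 by (intro power_strict_increasing) auto
    show "0 < card (insert 0 Z)" using finZ by (simp add: card_gt_0_iff)
  qed
  then have "card (insert 0 Z) * CARD('a) ^ j \<le> CARD('a) ^ card B" using Suc.prems by linarith
  then obtain D where D: "finite D" "independent D" "D \<subseteq> span B" "card D = j" "span D \<inter> Z = {}"
    using Suc.IH by blast
  let ?W = "(\<lambda>(z, u). z + u) ` (insert 0 Z \<times> span D)"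
  note spD = card_span[OF D(1,2)]
  have "card ?W \<le> card (insert 0 Z \<times> span D)"
    using finZ spD by (intro card_image_le) auto
  also have "\<dots> = card (insert 0 Z) * CARD('a) ^ j" using spD D by (simp add: card_cartesian_product)
  also have "\<dots> < CARD('a) ^ card B" using less Suc.prems by linarith
  also have "\<dots> = card (span B)" using card_span[OF B] by simp
  finally have "\<not> span B \<subseteq> ?W"
    using finZ spD card_mono[of ?W "span B"] by auto
  then obtain v where v: "v \<in> span B" "v \<notin> ?W" by blast
  have nW: "v \<noteq> z + u" if "z \<in> insert 0 Z" "u \<in> span D" for z u using v(2) that by force
  have vD: "v \<notin> span D" using nW[of 0] by auto
  then have "v \<notin> D" using span_base by blast
  have "y \<notin> Z" if yD: "y \<in> span (insert v D)" for y
  proof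
    assume y: "y \<in> Z"
    obtain k where k: "y - k \<odot> v \<in> span D" using yD by (auto simp: span_insert)
    have "k \<noteq> 0" using k y D(5) by auto
    have "v = inverse k \<odot> y + (- (inverse k \<odot> (y - k \<odot> v)))"
      using \<open>k \<noteq> 0\<close> by (simp add: scale_right_diff_distrib)
    moreover have "inverse k \<odot> y \<in> Z" using y \<open>k \<noteq> 0\<close> by (simp add: hom)
    moreover have "- (inverse k \<odot> (y - k \<odot> v)) \<in> span D" by (intro span_neg span_scale k)
    ultimately show False using nW by blast
  qed
  then show ?case
    using D vD v \<open>v \<notin> D\<close> by (intro exI[of _ "insert v D"]) (auto simp: independent_insertI)
qed

lemma homogeneous_on_line:
  assumes "\<And>c v. c \<noteq> 0 \<Longrightarrow> f (c \<odot> v) = f v" and "y \<in> span {v}" "y \<noteq> 0"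
  shows "f y = f v"
proof -
  obtain c where "y = c \<odot> v" using assms(2) by (auto simp: span_singleton)
  then show ?thesis using assms(1)[of c v] assms(3) by auto
qed

text \<open>Induction on the sum \<open>p\<close> of the \<open>t i - 1\<close>: a dense colour
  \<open>i\<close> yields a flat on whose direction space the target of \<open>i\<close> drops by
  one. The target \<open>T\<close> of colour \<open>b\<close> stays fixed, whatever value
  \<open>t\<close> has at \<open>b\<close>.\<close>

lemma monochromatic_subspace:
  assumes C: "cap_exponent C" and T: "2 \<le> T"
    and K: "finite K" "b \<notin> K"
    and hom: "\<And>c v. c \<noteq> 0 \<Longrightarrow> \<psi> (c \<odot> v) = \<psi> v"
  shows "(\<And>i. i \<in> K \<Longrightarrow> 1 \<le> t i) \<Longrightarrow> (\<Sum>i\<in>K. t i - 1) = p \<Longrightarrow> finite B \<Longrightarrow> independent B \<Longrightarrow>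
    ramsey_bound C T p \<le> card B \<Longrightarrow> (\<And>v. v \<in> span B \<Longrightarrow> v \<noteq> 0 \<Longrightarrow> \<psi> v \<in> insert b K) \<Longrightarrow>
    \<exists>i\<in>insert b K. \<exists>D. finite D \<and> independent D \<and> D \<subseteq> span B \<and> card D = (t(b := T)) i \<and>
      (\<forall>v\<in>span D - {0}. \<psi> v = i)"
proof (induction p arbitrary: t B)
  case p: (0 t B)
  have t: "t i = 1" if "i \<in> K" for i
  proof -
    have "t i - 1 = 0" using p(2) K that by simp
    then show ?thesis using p(1)[OF that] by simp
  qed
  show ?case
  proof (cases "\<exists>v\<in>span B - {0}. \<psi> v \<in> K")
    case True
    then obtain v where v: "v \<in> span B" "v \<noteq> 0" "\<psi> v \<in> K" by blast
    show ?thesis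
      using v t[of "\<psi> v"] K homogeneous_on_line[of \<psi>, OF hom]
      by (intro bexI[of _ "\<psi> v"] exI[of _ "{v}"]) auto
  next
    case False
    then have b: "\<psi> v = b" if "v \<in> span B" "v \<noteq> 0" for v using p(6)[OF that] that by auto
    obtain D where D: "D \<subseteq> B" "card D = T" "finite D"
      using obtain_subset_with_card_n p(5) by auto
    moreover have "D \<subseteq> span B" using D(1) span_superset by blast
    moreover have "\<psi> v = b" if "v \<in> span D - {0}" for v
      using b span_mono[OF D(1)] that by blast
    ultimately show ?thesis
      using p(4) independent_mono
      by (intro bexI[of _ b] exI[of _ D]) auto
  qed
next
  case (Suc p t B)
  note B = Suc.prems(3,4)
  define q where "q = CARD('a)"
  have q2: "q \<ge> 2" using CARD_ge_2 by (simp add: q_def)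
  define n where "n = card B"
  show ?case
  proof (cases "\<exists>v\<in>span B - {0}. \<psi> v \<in> K \<and> t (\<psi> v) = 1")
    case True
    then obtain v where v: "v \<in> span B" "v \<noteq> 0" "\<psi> v \<in> K" "t (\<psi> v) = 1" by blast
    show ?thesis
      using v K homogeneous_on_line[of \<psi>, OF hom]
      by (intro bexI[of _ "\<psi> v"] exI[of _ "{v}"]) auto
  next
    case no_trivial: False
    define K' where "K' = {i\<in>K. 2 \<le> t i}"
    have K': "finite K'" using K by (simp add: K'_def)
    have col: "\<psi> v \<in> insert b K'" if "v \<in> span B" "v \<noteq> 0" for v
    proof -
      have "t (\<psi> v) \<noteq> 1" if "\<psi> v \<in> K" using no_trivial \<open>v \<in> span B\<close> \<open>v \<noteq> 0\<close> that by auto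
      then show ?thesis using Suc.prems(6)[OF that] Suc.prems(1)[of "\<psi> v"] by (force simp: K'_def)
    qed
    have "card K' = (\<Sum>i\<in>K'. 1)" by simp
    also have "\<dots> \<le> (\<Sum>i\<in>K'. t i - 1)" by (intro sum_mono) (auto simp: K'_def)
    also have "\<dots> \<le> (\<Sum>i\<in>K. t i - 1)" using K by (intro sum_mono2) (auto simp: K'_def)
    finally have cardK': "card K' \<le> Suc p" using Suc.prems(2) by simp
    have Tn: "T \<le> n" using ramsey_bound_ge[of T C "Suc p"] Suc.prems(5) by (simp add: n_def)
    define A where "A i = {v \<in> span B - {0}. \<psi> v = i}" for i
    have finA: "finite (A i)" for i using card_span(1)[OF B] by (simp add: A_def)
    define Z where "Z = (\<Union>i\<in>K'. A i)"
    have finZ: "finite Z" using finA K' by (auto simp: Z_def)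
    show ?thesis
    proof (cases "card Z * q ^ T < q ^ n")
      case True
      \<comment> \<open>Strictness of the inequality leaves room for adding 0 to
        \<open>Z\<close>.\<close>
      have pw: "q ^ n = q ^ (n - T) * q ^ T" using Tn by (simp flip: power_add)
      have "card (insert 0 Z) = Suc (card Z)" using finZ by (auto simp: Z_def A_def)
      also have "\<dots> \<le> q ^ (n - T)" using True q2 unfolding pw by simp
      finally have small: "card (insert 0 Z) * CARD('a) ^ T \<le> CARD('a) ^ card B"
        using pw by (simp add: q_def n_def)
      have Z: "0 \<notin> Z" "Z \<subseteq> span B" by (auto simp: Z_def A_def)
      have "c \<odot> z \<in> Z" if "c \<noteq> 0" "z \<in> Z" for c z
        using that hom by (auto simp: Z_def A_def span_scale)
      from subspace_avoiding_small_set[OF B Z this small]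
      obtain D where D: "finite D" "independent D" "D \<subseteq> span B" "card D = T"
          "span D \<inter> Z = {}"
        by blast
      have "span D \<subseteq> span B" using D(3) by (simp add: span_minimal)
      then have "\<psi> v = b" if "v \<in> span D - {0}" for v
        using that col[of v] D(5) by (auto simp: Z_def A_def)
      then show ?thesis using D by (intro bexI[of _ b] exI[of _ D]) auto
    next
      case False
      then have Zbig: "q ^ n \<le> card Z * q ^ T" by simp
      \<comment> \<open>Each colour in \<open>K'\<close> contributes at least 1 to the sum, so there
        are at most \<open>p + 1\<close>, hence at most \<open>q ^ p\<close>, of them; pigeonhole
        costs the summand \<open>p\<close> in the exponent.\<close>
      have "\<exists>i\<in>K'. q ^ n \<le> card (A i) * q ^ (T + p)"
      proof (rule ccontr)
        assume none: "\<not> ?thesis"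
        have "card Z \<noteq> 0" using Zbig q2 by (auto intro: ccontr)
        then have "K' \<noteq> {}" by (auto simp: Z_def)
        have "q ^ n * q ^ p \<le> card Z * q ^ (T + p)"
          using mult_right_mono[OF Zbig, of "q ^ p"] by (simp add: power_add mult.assoc)
        also have "\<dots> \<le> (\<Sum>i\<in>K'. card (A i)) * q ^ (T + p)"
          unfolding Z_def by (intro mult_right_mono card_UN_le K') auto
        also have "\<dots> = (\<Sum>i\<in>K'. card (A i) * q ^ (T + p))" by (rule sum_distrib_right)
        also have "\<dots> < (\<Sum>i\<in>K'. q ^ n)"
          using none K' \<open>K' \<noteq> {}\<close> by (intro sum_strict_mono) (auto simp: not_le)
        also have "\<dots> = card K' * q ^ n" by simp
        also have "\<dots> \<le> q ^ p * q ^ n"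
        proof (intro mult_right_mono)
          have "Suc p \<le> 2 ^ p" by (simp add: Suc_leI less_exp)
          also have "\<dots> \<le> q ^ p" using q2 by (intro power_mono) auto
          finally show "card K' \<le> q ^ p" using cardK' by linarith
        qed auto
        finally show False by simp
      qed
      then obtain i where i: "i \<in> K'" and dense: "q ^ n \<le> card (A i) * q ^ (T + p)" by blast
      have iK: "i \<in> K" "i \<noteq> b" "2 \<le> t i" using i K by (auto simp: K'_def)
      have "A i \<subseteq> span B" by (auto simp: A_def)
      then have "\<exists>x D. finite D \<and> independent D \<and> D \<subseteq> span B \<and>
          card D = ramsey_bound C T p \<and> (\<forall>u\<in>span D. x + u \<in> A i)"
        using dense_set_contains_flat[OF C B, of "A i" "T + p" "ramsey_bound C T p"]
          dense T Suc.prems(5) by (simp add: q_def n_def)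
      then obtain x D where D: "finite D" "independent D" "D \<subseteq> span B"
          "card D = ramsey_bound C T p" and flat: "\<And>u. u \<in> span D \<Longrightarrow> x + u \<in> A i"
        by blast
      have DB: "span D \<subseteq> span B" using D(3) by (simp add: span_minimal)
      let ?t = "t(i := t i - 1)"
      have "(\<Sum>j\<in>K. ?t j - 1) = (?t i - 1) + (\<Sum>j\<in>K - {i}. ?t j - 1)"
        using K iK by (simp add: sum.remove)
      also have "(\<Sum>j\<in>K - {i}. ?t j - 1) = (\<Sum>j\<in>K - {i}. t j - 1)" by (intro sum.cong) auto
      finally have sum: "(\<Sum>j\<in>K. ?t j - 1) = p"
        using Suc.prems(2) iK K sum.remove[of K i "\<lambda>j. t j - 1"] by simp
      obtain j E where jE: "j \<in> insert b K" "finite E" "independent E" "E \<subseteq> span D"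
          "card E = (?t(b := T)) j" and mono: "\<And>v. v \<in> span E - {0} \<Longrightarrow> \<psi> v = j"
      proof -
        have "1 \<le> ?t j" if "j \<in> K" for j using Suc.prems(1)[OF that] iK by auto
        moreover have "\<psi> v \<in> insert b K" if "v \<in> span D" "v \<noteq> 0" for v
          using Suc.prems(6) DB that by auto
        ultimately show ?thesis
          using Suc.IH[of ?t D, OF _ sum D(1,2)] D(4) that by (metis order_refl)
      qed
      have ED: "span E \<subseteq> span D" using jE(4) by (simp add: span_minimal)
      have EB: "E \<subseteq> span B" using jE(4) DB by blast
      show ?thesis
      proof (cases "j = i")
        case False
        then show ?thesis using jE mono EB by (intro bexI[of _ j] exI[of _ E]) auto
      next
        case True
        \<comment> \<open>The flat \<open>x + span D\<close> lies in \<open>A i\<close>, which omits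
          0, so it is not a linear subspace and adjoining \<open>x\<close> raises the
          dimension.\<close>
        have "x \<notin> span D"
        proof
          assume "x \<in> span D"
          then have "x + (- x) \<in> A i" by (intro flat span_neg)
          then show False by (simp add: A_def)
        qed
        then have xE: "x \<notin> span E" using ED by blast
        then have "x \<notin> E" using span_base by blast
        have "x \<in> span B" using flat[of 0] by (simp add: span_zero A_def)
        \<comment> \<open>A vector with nonzero \<open>x\<close>-component rescales into the flat
          \<open>x + span D\<close>; one without lies in \<open>span E\<close>.\<close>
        have "\<psi> y = i" if y: "y \<in> span (insert x E) - {0}" for y
        proof -
          obtain k where k: "y - k \<odot> x \<in> span E" using y by (auto simp: span_insert)
          show ?thesis
          proof (cases "k = 0")
            case True
            then show ?thesis using k y mono[of y] \<open>j = i\<close> by simp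
          next
            case False
            have "inverse k \<odot> (y - k \<odot> x) \<in> span D" using k ED by (intro span_scale) auto
            then have "x + inverse k \<odot> (y - k \<odot> x) \<in> A i" by (rule flat)
            moreover have "x + inverse k \<odot> (y - k \<odot> x) = inverse k \<odot> y"
              using False by (simp add: scale_right_diff_distrib)
            ultimately show ?thesis using hom[of "inverse k" y] False by (simp add: A_def)
          qed
        qed
        then show ?thesis
          using jE True iK xE \<open>x \<notin> E\<close> \<open>x \<in> span B\<close> EB
          by (intro bexI[of _ i] exI[of _ "insert x E"]) (auto simp: independent_insertI)
      qed
    qed
  qed
qed

end

section \<open>Tower bounds\<close>

text \<open>Raising the base by one absorbs the lower-order terms that accompany
  \<open>C ^ D\<close> in the tower estimate.\<close>

lemma power_Suc_ge:
  fixes C :: nat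
  assumes "3 \<le> C" "2 \<le> D"
  shows "C ^ D + 3 * D \<le> (C + 1) ^ D"
  using assms(2)
proof (induction D rule: dec_induct)
  case base
  then show ?case using assms(1) by (simp add: power2_eq_square)
next
  case (step D)
  define X where "X = C * D"
  have "1 \<le> X" using mult_le_mono[of 1 C 1 D] step(1) assms(1) by (simp add: X_def)
  then have "C ^ Suc D + 3 * Suc D \<le> C ^ Suc D + C ^ D + 3 * X + 3 * D" by simp
  also have "\<dots> = (C + 1) * (C ^ D + 3 * D)" by (simp add: X_def algebra_simps)
  also have "\<dots> \<le> (C + 1) * (C + 1) ^ D" using step.IH by (intro mult_left_mono) auto
  finally show ?case by simp
qed

lemma two_mult_le_power_two: "1 \<le> y \<Longrightarrow> 2 * y \<le> 2 ^ y" for y :: nat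
  by (induction y rule: dec_induct) auto

text \<open>
  The extra summands \<open>ramsey_bound C T p + T + p\<close> on the left are the slack in the tower that
  pays for the factor \<open>T + p\<close> and for \<open>C\<close> exceeding the base \<open>\<sigma>\<close> in the next step.
\<close>

lemma ramsey_bound_le_tower:
  assumes C: "3 \<le> C" and \<sigma>: "2 \<le> \<sigma>" "real C + 1 \<le> \<sigma>\<^sup>2" and T: "2 \<le> T"
  shows "2 * real (ramsey_bound C T p) + real T + real p \<le> tw \<sigma> p (3 * real T)"
\<comment> \<open>At \<open>p = 0\<close> both sides equal \<open>3 * T\<close>; this is the origin
  of the top entry of the tower.\<close>
proof (induction p)
  case (Suc p)
  define D where "D = ramsey_bound C T p"
  define Y where "Y = T + p"
  have D: "2 \<le> D" using T ramsey_bound_ge[of T C p] by (simp add: D_def)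
  have Y: "1 \<le> Y" using T by (simp add: Y_def)
  have "2 * D + Y + 1 \<le> 3 * D * 2 ^ Y"
  proof -
    have "2 * D * 1 \<le> 2 * D * 2 ^ Y" by (intro mult_left_mono) auto
    moreover have "Y + 1 \<le> 2 ^ Y" by (simp add: Suc_leI less_exp)
    moreover have "1 * 2 ^ Y \<le> D * 2 ^ Y" using D by (intro mult_right_mono) auto
    ultimately show ?thesis by linarith
  qed
  moreover have "C ^ D * (2 * Y) \<le> C ^ D * 2 ^ Y"
    using two_mult_le_power_two[OF Y] by (intro mult_left_mono) auto
  ultimately have "(2 * D + Y + 1) + C ^ D * (2 * Y) \<le> 3 * D * 2 ^ Y + C ^ D * 2 ^ Y"
    by (rule add_mono)
  then have "2 * (D + C ^ D * Y) + Y + 1 \<le> (C ^ D + 3 * D) * 2 ^ Y"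
    by (simp add: algebra_simps)
  also have "\<dots> \<le> (C + 1) ^ D * 2 ^ Y"
    using power_Suc_ge[OF C D] by (intro mult_right_mono) auto
  finally have "real (2 * (D + C ^ D * Y) + Y + 1) \<le> real ((C + 1) ^ D * 2 ^ Y)"
    by (simp only: of_nat_le_iff)
  also have "\<dots> = (real C + 1) ^ D * 2 ^ Y" by (simp add: add.commute)
  \<comment> \<open>Trading the base \<open>C + 1\<close> for \<sigma> doubles the exponent
    \<open>D\<close>, which is why the induction carries twice the Ramsey bound.\<close>
  also have "\<dots> \<le> (\<sigma>\<^sup>2) ^ D * \<sigma> ^ Y" using \<sigma> by (intro mult_mono power_mono) auto
  also have "\<dots> = \<sigma> ^ (2 * D + Y)" by (simp add: power_mult power_add)
  also have "\<dots> = \<sigma> powr (real (2 * D + Y))" using \<sigma> by (subst powr_realpow) auto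
  also have "\<dots> \<le> \<sigma> powr (tw \<sigma> p (3 * real T))"
    using \<sigma> Suc.IH by (intro powr_mono) (auto simp: D_def Y_def)
  finally show ?case by (simp add: D_def Y_def algebra_simps)
qed simp

section \<open>Numerical bounds on the constants \<open>gamma0\<close> and \<open>C0\<close>\<close>

lemma gamma0_bounds: "5 / 2 \<le> gamma0" "gamma0 < 3"
proof -
  let ?f = "\<lambda>x::real. (1 + x + x^2) / x powr (2/3)"
  have ge: "5 / 2 \<le> ?f x" if x: "x \<in> {0<..<1}" for x
  proof -
    \<comment> \<open>AM-GM for \<open>a, b, b\<close>, where \<open>a + 2 b\<close> is the tangent of \<open>1 + x + x\<^sup>2\<close> at \<open>3/5\<close>,
      close to the minimiser\<close>
    define a where "a = (16/25 :: real)"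
    define b where "b = 11/10 * x"
    have "(5 / 2 * x powr (2/3)) ^ 3 = 125 / 8 * x\<^sup>2"
      using x by (simp add: power_mult_distrib powr_power power_divide)
    also have "\<dots> \<le> 27 * a * b\<^sup>2" by (simp add: a_def b_def power2_eq_square)
    also have "\<dots> \<le> (a + 2 * b) ^ 3"
    proof -
      have "(a + 2 * b) ^ 3 - 27 * a * b\<^sup>2 = (a - b)\<^sup>2 * (a + 8 * b)"
        by (simp add: power2_eq_square power3_eq_cube algebra_simps)
      also have "\<dots> \<ge> 0" using x by (auto simp: a_def b_def)
      finally show ?thesis by simp
    qed
    also have "\<dots> \<le> (1 + x + x\<^sup>2) ^ 3"
    proof (rule power_mono)
      have "1 + x + x\<^sup>2 - (a + 2 * b) = (x - 3/5)\<^sup>2"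
        by (simp add: a_def b_def power2_eq_square algebra_simps)
      then show "a + 2 * b \<le> 1 + x + x\<^sup>2" by (metis zero_le_power2 diff_ge_0_iff_ge)
    qed (use x in \<open>auto simp: a_def b_def\<close>)
    finally have "5 / 2 * x powr (2/3) \<le> 1 + x + x\<^sup>2"
      by (subst (asm) power_mono_iff) (use x in auto)
    then show ?thesis using x by (simp add: pos_le_divide_eq)
  qed
  show "5 / 2 \<le> gamma0"
    unfolding gamma0_def using ge by (intro cInf_greatest) auto
  have "gamma0 \<le> ?f (1/2)"
    unfolding gamma0_def using ge
    by (intro cInf_lower imageI bdd_belowI[of _ "5/2"]) (force simp del: divide_le_eq_numeral1 le_divide_eq_numeral1)+
  also have "\<dots> < 3"
  proof -
    \<comment> \<open>At 1/2 the numerator is 7/4, so a value below 3 needs the denominator to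
      exceed 7/12; cubing turns this into \<open>(7/12) ^ 3 < 1/4\<close>.\<close>
    have "(7 / 12 :: real) ^ 3 < ((1/2) powr (2/3)) ^ 3"
      by (simp add: powr_power power_divide)
    then have "7 / 12 < (1/2 :: real) powr (2/3)" by (rule power_less_imp_less_base) simp
    then show ?thesis by (simp add: pos_divide_less_eq power2_eq_square)
  qed
  finally show "gamma0 < 3" .
qed

text \<open>Since \<open>3 ^ 4 = 81\<close> is below \<open>(5/2) ^ 5\<close>, the logarithm of
  \<open>gamma0\<close> to base 3 is at least 4/5, so \<open>1 / (1 - log 3 gamma0)\<close> is at
  least 5.\<close>

lemma C0_ge_6: "6 \<le> C0"
proof -
  have "(3 powr (4/5) :: real) ^ 5 \<le> (5/2) ^ 5" by (simp add: powr_power power_divide)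
  then have "3 powr (4/5) \<le> (5/2 :: real)"
    by (metis power_le_imp_le_base[of _ 4] numeral_eq_Suc pred_numeral_simps zero_le_divide_iff zero_le_numeral)
  then have "3 powr (4/5) \<le> gamma0" using gamma0_bounds by linarith
  then have "4/5 \<le> log 3 gamma0" using gamma0_bounds by (subst le_log_iff) auto
  moreover have "log 3 gamma0 < 1" using gamma0_bounds by (simp add: log_less_iff)
  ultimately have "5 \<le> 1 / (1 - log 3 gamma0)" by (simp add: pos_le_divide_eq)
  then show ?thesis by (simp add: C0_def)
qed

section \<open>Coordinate spaces\<close>

interpretation vs: finite_field_space "vscale :: 'a::{finite,field} \<Rightarrow> (nat \<Rightarrow> 'a) \<Rightarrow> nat \<Rightarrow> 'a"
  by unfold_locales (auto simp: vscale_def fun_eq_iff algebra_simps)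

text \<open>Presents the coordinate space as the span of a finite independent set, the form in which
  the abstract results apply.\<close>

lemma Fspace_basis:
  "\<exists>B :: (nat \<Rightarrow> 'a::{finite,field}) set. finite B \<and> vs.independent B \<and> card B = n \<and> vs.span B = Fspace n"
proof (induction n)
  case 0
  show ?case by (intro exI[of _ "{}"]) (auto simp: Fspace_def vs.independent_empty)
next
  case (Suc n)
  then obtain B :: "(nat \<Rightarrow> 'a) set" where
    B: "finite B" "vs.independent B" "card B = n" "vs.span B = Fspace n" by blast
  define e :: "nat \<Rightarrow> 'a" where "e = (\<lambda>i. if i = n then 1 else 0)"
  have e: "e \<notin> vs.span B" by (auto simp: B(4) Fspace_def e_def)
  then have "e \<notin> B" using vs.span_base by blast
  have "vs.span (insert e B) = Fspace (Suc n)"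
  proof (intro equalityI subsetI)
    fix x assume "x \<in> vs.span (insert e B)"
    then obtain k where k: "x - vscale k e \<in> Fspace n" by (auto simp: vs.span_insert B(4))
    have "x i = 0" if "i \<ge> Suc n" for i
    proof -
      have "(x - vscale k e) i = 0" using k that by (auto simp: Fspace_def)
      then show ?thesis using that by (simp add: vscale_def e_def)
    qed
    then show "x \<in> Fspace (Suc n)" by (simp add: Fspace_def)
  next
    fix x :: "nat \<Rightarrow> 'a" assume "x \<in> Fspace (Suc n)"
    then have "x - vscale (x n) e \<in> Fspace n"
      by (auto simp: Fspace_def vscale_def e_def le_Suc_eq Suc_le_eq)
    then show "x \<in> vs.span (insert e B)" by (auto simp: vs.span_insert B(4))
  qed
  then show ?case
    using B e \<open>e \<notin> B\<close> by (intro exI[of _ "insert e B"]) (auto simp: vs.independent_insertI)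
qed

lemma points_eq_spans:
  "points n = {vs.span {v} | v :: nat \<Rightarrow> 'a::{finite,field}. v \<in> Fspace n \<and> v \<noteq> 0}"
proof (intro equalityI subsetI)
  fix L :: "(nat \<Rightarrow> 'a) set" assume "L \<in> points n"
  then have L: "vs.subspace L" "L \<subseteq> Fspace n" "vs.dim L = 1"
    by (auto simp: points_def lin_subspace_def sdim_def)
  obtain B where B: "B \<subseteq> L" "vs.independent B" "L \<subseteq> vs.span B" "card B = vs.dim L"
    using vs.basis_exists by blast
  then obtain v where v: "B = {v}" using L(3) card_1_singletonE by metis
  have "L = vs.span {v}" using B L(1) v by (metis vs.span_subspace)
  moreover have "v \<noteq> 0" using B(2) v by simp
  ultimately show "L \<in> {vs.span {v} | v. v \<in> Fspace n \<and> v \<noteq> 0}" using B(1) L(2) v by auto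
next
  fix L :: "(nat \<Rightarrow> 'a) set" assume "L \<in> {vs.span {v} | v. v \<in> Fspace n \<and> v \<noteq> 0}"
  then obtain v where v: "L = vs.span {v}" "v \<in> Fspace n" "v \<noteq> 0" by blast
  obtain B :: "(nat \<Rightarrow> 'a) set" where "vs.span B = Fspace n" using Fspace_basis by blast
  then have "L \<subseteq> Fspace n" using v by (metis vs.span_minimal vs.subspace_span empty_subsetI insert_subset)
  moreover have "vs.dim L = 1" using v vs.dim_span_eq_card_independent[of "{v}"] by simp
  ultimately show "L \<in> points n" using v by (simp add: points_def lin_subspace_def sdim_def)
qed

lemma ramsey_prop_ramsey_bound:
  fixes t :: "nat \<Rightarrow> nat"
  assumes C: "finite_field_space.cap_exponent (vscale :: 'a::{finite,field} \<Rightarrow> (nat \<Rightarrow> 'a) \<Rightarrow> nat \<Rightarrow> 'a) C"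
    and k: "2 \<le> k" and t: "\<forall>i\<in>{1..k}. 2 \<le> t i"
  shows "ramsey_prop TYPE('a) k t (ramsey_bound C (t k) (\<Sum>i=1..k-1. t i - 1))"
  unfolding ramsey_prop_def
proof (intro allI impI)
  let ?n = "ramsey_bound C (t k) (\<Sum>i=1..k-1. t i - 1)"
  fix f :: "(nat \<Rightarrow> 'a) set \<Rightarrow> nat" assume f: "\<forall>L\<in>points ?n. f L \<in> {1..k}"
  define \<psi> where "\<psi> v = f (vs.span {v})" for v
  obtain B :: "(nat \<Rightarrow> 'a) set" where
    B: "finite B" "vs.independent B" "card B = ?n" "vs.span B = Fspace ?n"
    using Fspace_basis by blast
  have hom: "\<psi> (vscale c v) = \<psi> v" if "c \<noteq> 0" for c v
  proof -
    have "v = vscale (inverse c) (vscale c v)" using that by simp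
    then have "vs.span {vscale c v} = vs.span {v}"
      unfolding vs.span_eq by (metis empty_subsetI insert_subset vs.span_base vs.span_scale insertI1)
    then show ?thesis by (simp add: \<psi>_def)
  qed
  have range: "insert k {1..k - 1} = {1..k}" using k by auto
  \<comment> \<open>The trivial update \<open>t(k := t k)\<close> matches the general statement with
    \<open>b = k\<close> and \<open>T = t k\<close>.\<close>
  have "\<exists>i\<in>insert k {1..k - 1}. \<exists>D. finite D \<and> vs.independent D \<and> D \<subseteq> vs.span B \<and>
      card D = (t(k := t k)) i \<and> (\<forall>v\<in>vs.span D - {0}. \<psi> v = i)"
  proof (rule vs.monochromatic_subspace[OF C])
    show "2 \<le> t k" using t k by auto
    show "k \<notin> {1..k - 1}" using k by auto
    show "1 \<le> t i" if "i \<in> {1..k - 1}" for i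
    proof -
      have "i \<in> {1..k}" using that by auto
      then show ?thesis using t by fastforce
    qed
    show "\<psi> v \<in> insert k {1..k - 1}" if "v \<in> vs.span B" "v \<noteq> 0" for v
      using that f unfolding range \<psi>_def B(4) points_eq_spans by blast
  qed (use hom B in auto)
  then obtain i D where i: "i \<in> {1..k}" and D: "vs.independent D" "D \<subseteq> Fspace ?n" "card D = t i"
      and mono: "\<And>v. v \<in> vs.span D - {0} \<Longrightarrow> \<psi> v = i"
    unfolding range B(4) by auto
  show "\<exists>i\<in>{1..k}. \<exists>U. lin_subspace ?n U \<and> sdim U = t i \<and> (\<forall>L\<in>points ?n. L \<subseteq> U \<longrightarrow> f L = i)"
  proof (intro bexI[OF _ i] exI[of _ "vs.span D"] conjI ballI impI)
    show "lin_subspace ?n (vs.span D)"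
      using D(2) B(4) vs.span_minimal[of D "Fspace ?n"] by (metis lin_subspace_def vs.subspace_span)
    show "sdim (vs.span D) = t i"
      using D by (simp add: sdim_def vs.dim_eq_card_independent)
  next
    fix L assume L: "L \<in> points ?n" "L \<subseteq> vs.span D"
    then obtain v where v: "L = vs.span {v}" "v \<noteq> 0" by (auto simp: points_eq_spans)
    then have "v \<in> vs.span D - {0}" using L(2) vs.span_base[of v "{v}"] by auto
    then show "f L = i" using mono v by (simp add: \<psi>_def)
  qed
qed

theorem theorem1p3:
  fixes t :: "nat \<Rightarrow> nat" and k q :: nat
  assumes "CARD('a::{finite,field}) = q"
    and "q \<in> {2, 3}"
    and "k \<ge> 2"
    and "\<forall>i\<in>{1..k}. t i \<ge> 2"
    and "\<forall>i\<in>{1..<k}. t i \<le> t (Suc i)"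
  shows "real (Rq TYPE('a) k t)
           \<le> tau (sigma q) ((\<Sum>i=1..k-1. (t i - 1)) + 1) (3 * real (t k))"
proof -
  define p where "p = (\<Sum>i=1..k-1. t i - 1)"
  \<comment> \<open>The last condition reads \<open>3 + 1 = 2 ^ 2\<close> for \<open>q = 2\<close>;
    for \<open>q = 3\<close> it follows from \<open>32 + 1\<close> being at most
    \<open>6 ^ 2\<close>.\<close>
  obtain C where C: "finite_field_space.cap_exponent (vscale :: 'a \<Rightarrow> (nat \<Rightarrow> 'a) \<Rightarrow> nat \<Rightarrow> 'a) C"
    and \<sigma>: "3 \<le> C" "2 \<le> sigma q" "real C + 1 \<le> (sigma q)\<^sup>2"
  proof (cases "q = 2")
    case True
    then have "CARD('a) = 2" using assms(1) by simp
    then show ?thesis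
      by (rule that[OF vs.cap_exponent_CARD_2]) (simp_all add: True sigma_def)
  next
    case False
    then have "CARD('a) = 3" "sigma q = C0" using assms(1,2) by (auto simp: sigma_def)
    moreover have "real 32 + 1 \<le> C0\<^sup>2" using power_mono[OF C0_ge_6, of 2] by simp
    ultimately show ?thesis
      using C0_ge_6 by (intro that[OF vs.cap_exponent_CARD_3]) auto
  qed
  have "Rq TYPE('a) k t \<le> ramsey_bound C (t k) p"
    unfolding Rq_def p_def using ramsey_prop_ramsey_bound[OF C assms(3,4)] by (rule Least_le)
  then have "real (Rq TYPE('a) k t) \<le> 2 * real (ramsey_bound C (t k) p) + real (t k) + real p"
    by simp
  also have "\<dots> \<le> tw (sigma q) p (3 * real (t k))"
    using ramsey_bound_le_tower[OF \<sigma>] assms(3,4) by auto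
  finally show ?thesis by (simp add: tau_def p_def)
qed

end
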